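(* Let $\varphi:\mathbb T^d\to\mathbb T^d$ be the piecewise affine linear Bernoulli map, and $(X_n)$ the Markov process $X_{n+1}=\varphi(X_n)+\epsilon\zeta_{n+1}$, described in the context. Suppose the Cubes Assumption (stated in the context) holds, and that for all sufficiently small $\epsilon>0$, $$\int_{\mathbb T^d}d(y,0)\,K_\epsilon(y)\,\pi(dy)\le\epsilon .$$ Then there is a constant $C$ (independent of $\delta$ and $\epsilon$) such that for every $\delta\in(0,1)$ and all sufficiently small $\epsilon>0$, $$\frac{d\ln\epsilon}{\ln p_{\max}}-C\bigl(1+|\ln(1-\delta)|\bigr)\le t_{\mathrm{mix}}(\delta).$$
   Context: **Process.** $\mathbb T^d=\mathbb R^d/\mathbb Z^d$, $\Pi:\mathbb R^d\to\mathbb T^d$ is the canonical projection, $\pi$ is Lebesgue (probability) measure on $\mathbb T^d$, and $d(y,0)$ is the torus distance between $y$ and $0$. For $x\in\mathbb T^d$, $\check x\in[0,1)^d$ is the unique point with $\Pi(\check x)=x$. For each $\epsilon>0$, $(\epsilon\zeta_n)_{n\ge1}$ are i.i.d. $\mathbb T^d$-valued random variables, independent of $X_0$, whose law has density $K_\epsilon$ with respect to $\pi$, and $X_{n+1}=\varphi(X_n)+\epsilon\zeta_{n+1}$. **Mixing time.** $t_{\mathrm{mix}}(\delta)=\min\{n\in\mathbb N:\ \|\mathrm{dist}(X_n)-\pi\|_{TV}\le\delta\text{ for all initial distributions of }X_0\}$. Total variation is normalized so that $\|\mu-\pi\|_{TV}=\frac12\|f-1\|_{L^1(\pi)}$ if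 $\mu=f\,\pi$, i.e. $\|\mu-\nu\|_{TV}=\sup_A|\mu(A)-\nu(A)|$. **The map $\varphi$.** Let $M\ge2$, $\mathcal I=\{1,\dots,M\}$, and let $\check E_1,\dots,\check E_M$ be a partition of $[0,1)^d$; if $d=1$ each $\check E_i$ is an interval, if $d>1$ each $\check E_i$ is a $d$-dimensional cube with sides parallel to the coordinate axes. Let $p_i\in(0,1)$ be the Lebesgue measure of $\check E_i$, and $p_{\max}=\max_ip_i$. Assume $\check\varphi_i:\check E_i\to[0,1)^d$ are affine bijections $\check\varphi_i(\check x)=p_i^{-1/d}\check D_i\check x+\check e_i$ with $\check e_i\in\mathbb R^d$ and $\check D_i$ orthogonal matrices. Let $E_i=\Pi(\check E_i)$, $\varphi_i(x)=\Pi(\check\varphi_i(\check x))$ for $x\in E_i$, and $\varphi(x)=\varphi_i(x)$ if $x\in E_i$. **Cylinder sets.** $\mathcal T$ is the set of all finite tuples with entries in $\mathcal I$, including the empty tuple $\mathbf 0$. For $s=(s_0,\dots,s_{m-1})\in\mathcal T$, $|s|=m$ and $\mathcal C_s=\{x\in\mathbb T^d:\varphi^n(x)\in E_{s_n}\text{ for all }0\le n<|s|\}$; $\mathcal C_{\mathbf 0}=\mathbb T^d$. **Cubes Assumption.** (1) Each $\varphi_i:E_i\to\mathbb T^d$ is a bijection. (2) For every $\check x\in\partial[0,1]^d$ there exist $i\in\mathcal I$ and $\check y\in(0,1)^d$ such that $\check\varphi_i(\check y)=\check x$, where $\check\varphi_i$ here denotes the affine map on $\mathbb R^d$ given by the same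 formula. (3) If $d\ge2$, every cylinder set $\mathcal C_s$ is an axis-aligned cube. *)

theory Defs
  imports "HOL-Probability.Probability"
begin

section \<open>The torus\<close>

definition same_mod_int :: "real^'d \<Rightarrow> real^'d \<Rightarrow> bool" where
  "same_mod_int x y \<longleftrightarrow> (\<forall>j. x $ j - y $ j \<in> \<int>)"

lemma equivp_same_mod_int: "equivp (same_mod_int :: real^'d \<Rightarrow> _)"
proof (rule equivpI)
  show "reflp (same_mod_int :: real^'d \<Rightarrow> _)"
    by (simp add: reflp_def same_mod_int_def)
  show "symp (same_mod_int :: real^'d \<Rightarrow> _)"
    unfolding symp_def same_mod_int_def by (metis Ints_minus minus_diff_eq)
  show "transp (same_mod_int :: real^'d \<Rightarrow> _)"
  proof (rule transpI)
    fix x y z :: "real^'d"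
    assume xy: "same_mod_int x y" and yz: "same_mod_int y z"
    have "x $ j - z $ j = (x $ j - y $ j) + (y $ j - z $ j)" for j
      by simp
    with xy yz show "same_mod_int x z"
      unfolding same_mod_int_def by (metis Ints_add)
  qed
qed

quotient_type 'd torus = "real^('d::finite)" / same_mod_int
  morphisms rep_torus torus_proj
  by (rule equivp_same_mod_int)

lemma torus_proj_eq_iff: "torus_proj x = torus_proj y \<longleftrightarrow> same_mod_int x y"
  by (rule torus.abs_eq_iff)

lemma torus_proj_surj: "surj torus_proj"
  by (rule surjI[of _ rep_torus]) (rule Quotient3_abs_rep[OF Quotient3_torus])

instantiation torus :: (finite) ab_group_add
begin

lift_definition zero_torus :: "'a torus" is 0 .

lift_definition plus_torus :: "'a torus \<Rightarrow> 'a torus \<Rightarrow> 'a torus" is "(+)"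
proof -
  fix a b c d :: "real^'a"
  assume ab: "same_mod_int a b" and cd: "same_mod_int c d"
  have "(a + c) $ j - (b + d) $ j = (a $ j - b $ j) + (c $ j - d $ j)" for j
    by simp
  with ab cd show "same_mod_int (a + c) (b + d)"
    unfolding same_mod_int_def by (metis Ints_add)
qed

lift_definition uminus_torus :: "'a torus \<Rightarrow> 'a torus" is uminus
proof -
  fix a b :: "real^'a"
  assume ab: "same_mod_int a b"
  have "(- a) $ j - (- b) $ j = - (a $ j - b $ j)" for j
    by simp
  with ab show "same_mod_int (- a) (- b)"
    unfolding same_mod_int_def by (metis Ints_minus)
qed

lift_definition minus_torus :: "'a torus \<Rightarrow> 'a torus \<Rightarrow> 'a torus" is "(-)"
proof -
  fix a b c d :: "real^'a"
  assume ab: "same_mod_int a b" and cd: "same_mod_int c d"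
  have "(a - c) $ j - (b - d) $ j = (a $ j - b $ j) - (c $ j - d $ j)" for j
    by simp
  with ab cd show "same_mod_int (a - c) (b - d)"
    unfolding same_mod_int_def by (metis Ints_diff)
qed

instance
  by standard (transfer, simp add: same_mod_int_def algebra_simps)+

end

text \<open>The quotient topology; in particular \<^const>\<open>borel\<close> is available on the torus.\<close>

instantiation torus :: (finite) topological_space
begin

definition open_torus :: "'a torus set \<Rightarrow> bool" where
  "open_torus U \<longleftrightarrow> open (torus_proj -` U)"

instance
proof
  show "open (UNIV :: 'a torus set)"
    by (simp add: open_torus_def)
  show "open (S \<inter> T)" if "open S" "open T" for S T :: "'a torus set"
    using that by (auto simp: open_torus_def)
  show "open (\<Union> K)" if "\<forall>S\<in>K. open S" for K :: "'a torus set set"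
    using that by (auto simp: open_torus_def vimage_Union)
qed

end

definition torus_dist :: "'d::finite torus \<Rightarrow> 'd torus \<Rightarrow> real" where
  "torus_dist x y = Inf {norm (a - b) | a b. torus_proj a = x \<and> torus_proj b = y}"

definition unit_cube :: "(real^'d) set" where
  "unit_cube = {x. \<forall>j. 0 \<le> x $ j \<and> x $ j < 1}"

lemma ex1_lift: "\<exists>!y. y \<in> unit_cube \<and> torus_proj y = (x :: 'd::finite torus)"
proof -
  obtain a where a: "torus_proj a = x"
    using torus_proj_surj by (metis surjD)
  show ?thesis
  proof (intro ex1I conjI)
    show "(\<chi> j. frac (a $ j)) \<in> unit_cube"
      by (simp add: unit_cube_def frac_lt_1)
    show "torus_proj (\<chi> j. frac (a $ j)) = x"
      unfolding a[symmetric] torus_proj_eq_iff same_mod_int_def by (simp add: frac_def)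
  next
    fix y assume y: "y \<in> unit_cube \<and> torus_proj y = x"
    then have "same_mod_int y a"
      using a by (simp add: torus_proj_eq_iff[symmetric])
    have "frac (a $ j) = y $ j" for j
    proof -
      have "y $ j - a $ j \<in> \<int>"
        using \<open>same_mod_int y a\<close> unfolding same_mod_int_def by blast
      then have "- (y $ j - a $ j) \<in> \<int>"
        by (rule Ints_minus)
      then show ?thesis
        using y by (simp add: frac_unique_iff unit_cube_def)
    qed
    then show "y = (\<chi> j. frac (a $ j))"
      by (simp add: vec_eq_iff)
  qed
qed

definition torus_lift :: "'d::finite torus \<Rightarrow> real^'d" where
  "torus_lift x = (THE y. y \<in> unit_cube \<and> torus_proj y = x)"

definition torus_lebesgue :: "'d::finite torus measure" where
  "torus_lebesgue = distr (restrict_space lborel unit_cube) borel torus_proj"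

section \<open>Piecewise affine linear Bernoulli maps\<close>

text \<open>A cube may contain any part of its faces: the half-open cubes occurring in a partition of
  \<^const>\<open>unit_cube\<close> are included.\<close>

definition axis_cube :: "(real^'d) set \<Rightarrow> bool" where
  "axis_cube Q \<longleftrightarrow> (\<exists>(a :: real^'d) l (I :: 'd \<Rightarrow> real set). 0 < l
     \<and> (\<forall>j. {a $ j <..< a $ j + l} \<subseteq> I j \<and> I j \<subseteq> {a $ j .. a $ j + l})
     \<and> Q = {x. \<forall>j. x $ j \<in> I j})"

text \<open>Throughout, \<open>M\<close> is the number of pieces, \<open>E i\<close> (for \<open>i \<in> {1..M}\<close>) are the pieces as
  subsets of \<^const>\<open>unit_cube\<close>, and \<open>D i\<close>, \<open>e i\<close> are the orthogonal and the translation part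
  of the \<open>i\<close>-th affine branch.\<close>

definition piece_prob :: "(nat \<Rightarrow> (real^'d) set) \<Rightarrow> nat \<Rightarrow> real" where
  "piece_prob E i = measure lborel (E i)"

definition p_max :: "nat \<Rightarrow> (nat \<Rightarrow> (real^'d) set) \<Rightarrow> real" where
  "p_max M E = Max (piece_prob E ` {1..M})"

definition affine_branch ::
  "(nat \<Rightarrow> (real^'d) set) \<Rightarrow> (nat \<Rightarrow> real^'d^'d) \<Rightarrow> (nat \<Rightarrow> real^'d) \<Rightarrow> nat \<Rightarrow> real^'d \<Rightarrow> real^'d"
where
  "affine_branch E D e i x =
     (piece_prob E i powr (- 1 / real CARD('d))) *\<^sub>R (D i *v x) + e i"

definition torus_piece :: "(nat \<Rightarrow> (real^'d::finite) set) \<Rightarrow> nat \<Rightarrow> 'd torus set" where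
  "torus_piece E i = torus_proj ` E i"

definition torus_branch ::
  "(nat \<Rightarrow> (real^'d::finite) set) \<Rightarrow> (nat \<Rightarrow> real^'d^'d) \<Rightarrow> (nat \<Rightarrow> real^'d)
     \<Rightarrow> nat \<Rightarrow> 'd torus \<Rightarrow> 'd torus"
where
  "torus_branch E D e i x = torus_proj (affine_branch E D e i (torus_lift x))"

definition bernoulli_map ::
  "nat \<Rightarrow> (nat \<Rightarrow> (real^'d::finite) set) \<Rightarrow> (nat \<Rightarrow> real^'d^'d) \<Rightarrow> (nat \<Rightarrow> real^'d)
     \<Rightarrow> 'd torus \<Rightarrow> 'd torus"
where
  "bernoulli_map M E D e x =
     torus_branch E D e (THE i. i \<in> {1..M} \<and> x \<in> torus_piece E i) x"

locale piecewise_affine_bernoulli =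
  fixes M :: nat
    and E :: "nat \<Rightarrow> (real^'d::finite) set"
    and D :: "nat \<Rightarrow> real^'d^'d"
    and e :: "nat \<Rightarrow> real^'d"
  assumes two_pieces: "2 \<le> M"
    and pieces_disjoint: "disjoint_family_on E {1..M}"
    and pieces_cover: "(\<Union>i\<in>{1..M}. E i) = unit_cube"
    and pieces_intervals: "CARD('d) = 1 \<Longrightarrow> i \<in> {1..M} \<Longrightarrow> is_interval (E i)"
    and pieces_cubes: "CARD('d) > 1 \<Longrightarrow> i \<in> {1..M} \<Longrightarrow> axis_cube (E i)"
    and piece_prob_pos: "i \<in> {1..M} \<Longrightarrow> 0 < piece_prob E i"
    and piece_prob_less_1: "i \<in> {1..M} \<Longrightarrow> piece_prob E i < 1"
    and orthogonal: "i \<in> {1..M} \<Longrightarrow> orthogonal_matrix (D i)"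
    and affine_bij: "i \<in> {1..M} \<Longrightarrow> bij_betw (affine_branch E D e i) (E i) unit_cube"

definition cylinder ::
  "nat \<Rightarrow> (nat \<Rightarrow> (real^'d::finite) set) \<Rightarrow> (nat \<Rightarrow> real^'d^'d) \<Rightarrow> (nat \<Rightarrow> real^'d)
     \<Rightarrow> nat list \<Rightarrow> 'd torus set"
where
  "cylinder M E D e s =
     {x. \<forall>n < length s. (bernoulli_map M E D e ^^ n) x \<in> torus_piece E (s ! n)}"

text \<open>A subset of the torus is called an axis-aligned cube if its representatives in
  \<^const>\<open>unit_cube\<close> form one.\<close>

definition cubes_assumption ::
  "nat \<Rightarrow> (nat \<Rightarrow> (real^'d::finite) set) \<Rightarrow> (nat \<Rightarrow> real^'d^'d) \<Rightarrow> (nat \<Rightarrow> real^'d) \<Rightarrow> bool"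
where
  "cubes_assumption M E D e \<longleftrightarrow>
     (\<forall>i\<in>{1..M}. bij_betw (torus_branch E D e i) (torus_piece E i) UNIV)
   \<and> (\<forall>x \<in> frontier (cbox 0 1). \<exists>i\<in>{1..M}. \<exists>y \<in> box 0 1. affine_branch E D e i y = x)
   \<and> (CARD('d) \<ge> 2 \<longrightarrow> (\<forall>s \<in> lists {1..M}. axis_cube (torus_lift ` cylinder M E D e s)))"

section \<open>The noisy process and its mixing time\<close>

text \<open>The increment \<open>\<xi> n\<close>, used for \<open>n \<ge> 1\<close> only, is the whole noise term of step \<open>n\<close> (the
  noise amplitude is part of its law). Joint independence of \<open>X 0, \<xi> 1, \<xi> 2, \<dots>\<close> is expressed by
  putting \<open>X 0\<close> into the unused slot \<open>0\<close> of \<open>\<xi>\<close>.\<close>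

definition noisy_process ::
  "('d::finite torus \<Rightarrow> 'd torus) \<Rightarrow> ('d torus \<Rightarrow> real) \<Rightarrow> 'w measure
     \<Rightarrow> (nat \<Rightarrow> 'w \<Rightarrow> 'd torus) \<Rightarrow> (nat \<Rightarrow> 'w \<Rightarrow> 'd torus) \<Rightarrow> bool"
where
  "noisy_process \<phi> K P \<xi> X \<longleftrightarrow>
     prob_space P
   \<and> (\<forall>n\<ge>1. distributed P torus_lebesgue (\<xi> n) (\<lambda>y. ennreal (K y)))
   \<and> prob_space.indep_vars P (\<lambda>_. borel) (\<xi>(0 := X 0)) UNIV
   \<and> (\<forall>n. \<forall>\<omega>\<in>space P. X (Suc n) \<omega> = \<phi> (X n \<omega>) + \<xi> (Suc n) \<omega>)"

definition tv_dist :: "'a measure \<Rightarrow> 'a measure \<Rightarrow> real" where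
  "tv_dist \<mu> \<nu> = (SUP A \<in> sets \<nu>. \<bar>measure \<mu> A - measure \<nu> A\<bar>)"

text \<open>The process is taken on the path space \<^typ>\<open>nat \<Rightarrow> 'd torus\<close>. This loses no generality,
  since every initial law is realised there (see \<open>noisy_process_exists\<close> below) and, for
  measurable \<open>\<phi>\<close>, that law and \<open>K\<close> determine the law of \<open>X n\<close>. The minimum is \<open>\<infinity>\<close> if there is no such \<open>n\<close>.\<close>

definition mixing_time ::
  "('d::finite torus \<Rightarrow> 'd torus) \<Rightarrow> ('d torus \<Rightarrow> real) \<Rightarrow> real \<Rightarrow> enat"
where
  "mixing_time \<phi> K \<delta> = Inf {enat n | n.
     \<forall>(P :: (nat \<Rightarrow> 'd torus) measure) \<xi> X. noisy_process \<phi> K P \<xi> X \<longrightarrow>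
       tv_dist (distr P borel (X n)) torus_lebesgue \<le> \<delta>}"

lemma noisy_process_exists:
  fixes \<mu> :: "'d::finite torus measure"
  assumes \<mu>: "prob_space \<mu>" "sets \<mu> = sets borel"
    and K: "K \<in> borel_measurable torus_lebesgue"
      "prob_space (density torus_lebesgue (\<lambda>y. ennreal (K y)))"
  shows "\<exists>(P :: (nat \<Rightarrow> 'd torus) measure) \<xi> X.
           noisy_process \<phi> K P \<xi> X \<and> distr P borel (X 0) = \<mu>"
proof -
  define \<kappa> where "\<kappa> = density torus_lebesgue (\<lambda>y. ennreal (K y))"
  define N where "N n = (if n = 0 then \<mu> else \<kappa>)" for n :: nat
  define P where "P = PiM UNIV N"
  define \<xi> :: "nat \<Rightarrow> (nat \<Rightarrow> 'd torus) \<Rightarrow> 'd torus" where "\<xi> n \<omega> = \<omega> n" for n \<omega>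
  define X where "X n \<omega> = rec_nat (\<omega> 0) (\<lambda>k x. \<phi> x + \<omega> (Suc k)) n"
    for n and \<omega> :: "nat \<Rightarrow> 'd torus"
  have sets_N: "sets (N n) = sets borel" for n
    using \<mu> by (simp add: N_def \<kappa>_def torus_lebesgue_def)
  have N: "prob_space (N n)" for n
    using \<mu> K by (simp add: N_def \<kappa>_def)
  interpret product_prob_space N UNIV
    by (rule product_prob_spaceI) (rule N)
  have P: "prob_space P"
    unfolding P_def by (rule prob_space_PiM) (rule N)
  have comp: "distr P (N n) (\<lambda>\<omega>. \<omega> n) = N n" for n
    unfolding P_def by (rule PiM_component) simp
  have comp': "distr P M' (\<lambda>\<omega>. \<omega> n) = N n" if "sets M' = sets borel" for n M'
    using comp[of n] by (metis distr_cong sets_N that)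
  have meas: "(\<lambda>\<omega>. \<omega> n) \<in> measurable P (N n)" for n
    unfolding P_def by measurable
  have meas': "(\<lambda>\<omega>. \<omega> n) \<in> measurable P M'" if "sets M' = sets borel" for n M'
    using meas[of n] by (metis measurable_cong_sets sets_N that)
  have sets_tl: "sets (torus_lebesgue :: 'd torus measure) = sets borel"
    by (simp add: torus_lebesgue_def)
  have upd: "\<xi>(0 := X 0) = (\<lambda>n \<omega>. \<omega> n)"
    by (auto simp: fun_eq_iff \<xi>_def X_def)
  have "prob_space.indep_vars P (\<lambda>_. borel) (\<lambda>n \<omega>. \<omega> n) UNIV"
  proof (subst prob_space.indep_vars_iff_distr_eq_PiM[OF P])
    have "distr P (PiM UNIV (\<lambda>_. borel)) (\<lambda>x. \<lambda>i\<in>UNIV. x i) = distr P P (\<lambda>x. x)"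
      unfolding P_def by (rule distr_cong) (auto intro!: sets_PiM_cong simp: sets_N)
    also have "\<dots> = PiM UNIV N"
      by (simp add: P_def distr_id)
    also have "\<dots> = PiM UNIV (\<lambda>i. distr P borel (\<lambda>x. x i))"
      by (simp add: comp')
    finally show "distr P (PiM UNIV (\<lambda>_. borel)) (\<lambda>x. \<lambda>i\<in>UNIV. x i)
        = PiM UNIV (\<lambda>i. distr P borel (\<lambda>x. x i))" .
  qed (auto intro: meas')
  moreover have "distributed P torus_lebesgue (\<xi> n) (\<lambda>y. ennreal (K y))" if "n \<ge> 1" for n
    unfolding distributed_def \<xi>_def
    using comp'[OF sets_tl, of n] meas'[OF sets_tl, of n] K that
    by (simp add: N_def \<kappa>_def)
  moreover have "X (Suc n) \<omega> = \<phi> (X n \<omega>) + \<xi> (Suc n) \<omega>" for n \<omega>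
    by (simp add: X_def \<xi>_def)
  ultimately have "noisy_process \<phi> K P \<xi> X"
    unfolding noisy_process_def upd using P by blast
  moreover have "distr P borel (X 0) = \<mu>"
  proof -
    have "X 0 = (\<lambda>\<omega>. \<omega> 0)"
      by (simp add: X_def fun_eq_iff)
    then show ?thesis
      using comp'[of borel 0] by (simp add: N_def)
  qed
  ultimately show ?thesis by blast
qed

end

theory Submission
  imports Defs
begin

text \<open>Noise is too weak to spread mass over the torus before the map has expanded it. Let \<open>i\<close> be a
  piece of maximal measure \<open>p_max\<close> and \<open>q = p_max powr (- 1 / d) > 1\<close> the expansion factor of
  its branch; this is the smallest expansion factor that occurs, and the bound to be proved is
  \<open>ln (1 / \<epsilon>) / ln q\<close> up to an additive constant, because \<open>ln q = - ln p_max / d\<close>.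

  The process is started at the point \<open>y\<close> that \<open>n\<close> applications of branch \<open>i\<close> carry to the
  centre of the cube. The ball of radius \<open>r\<close> about the centre pulls back along this orbit to balls
  of radius \<open>r / q ^ (n - k)\<close> about the orbit points at time \<open>k\<close>, all inside the piece \<open>i\<close> when
  \<open>k < n\<close> (\<open>ex_backward_orbit\<close>). As long as the noisy orbit stays in these balls only branch
  \<open>i\<close> acts, and the displacement is multiplied by \<open>q\<close> in each step before the next noise term
  is added. Hence \<open>X n\<close> is within \<open>r\<close> of the centre as soon as the sum of the noise sizes,
  discounted by \<open>q ^ j\<close> at time \<open>j\<close>, is less than \<open>r / q ^ n\<close>
  (\<open>perturbed_orbit_dist_less\<close>). Aiming at an interior point, with a starting point
  that depends on \<open>n\<close>, avoids the question whether the fixed point of the branch lies on the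
  boundary of its piece.

  The discounted sum has mean at most \<open>\<epsilon> / (q - 1)\<close> for every \<open>n\<close>, so Markov's
  inequality bounds the probability of missing the ball by \<open>\<epsilon> * q ^ n / (r * (q - 1))\<close>
  (\<open>noise_sum_tail_le\<close>, \<open>ex_concentrated_process\<close>). The ball itself has Lebesgue measure at
  most \<open>2 * r\<close>. With \<open>r\<close> proportional to \<open>1 - \<delta>\<close>, the law of \<open>X n\<close> is further than
  \<open>\<delta>\<close> from Lebesgue measure whenever \<open>\<epsilon> * q ^ n\<close> is at most a constant times
  \<open>(1 - \<delta>)\<^sup>2\<close> (\<open>ex_process_tv_dist_gt\<close>). Taking logarithms gives the theorem.\<close>

section \<open>Representatives, distance and measurability on the torus\<close>

lemma torus_lift_mem: "torus_lift x \<in> unit_cube"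
  and torus_proj_lift [simp]: "torus_proj (torus_lift x) = x"
  using theI'[OF ex1_lift[of x]] by (auto simp: torus_lift_def)

lemma torus_lift_proj: "a \<in> unit_cube \<Longrightarrow> torus_lift (torus_proj a) = a"
  unfolding torus_lift_def by (rule the1_equality[OF ex1_lift]) simp

lemma torus_proj_add: "torus_proj (a + b) = torus_proj a + torus_proj b"
  by (simp add: plus_torus.abs_eq)

lemma torus_proj_diff: "torus_proj (a - b) = torus_proj a - torus_proj b"
  by (simp add: minus_torus.abs_eq)

lemma torus_proj_zero: "torus_proj 0 = 0"
  by (simp add: zero_torus_def)

lemma torus_dist_less_iff_pair:
  "torus_dist x y < r \<longleftrightarrow> (\<exists>a b. torus_proj a = x \<and> torus_proj b = y \<and> norm (a - b) < r)"
proof -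
  let ?S = "{norm (a - b) | a b. torus_proj a = x \<and> torus_proj b = y}"
  have "?S \<noteq> {}"
    using torus_proj_lift[of x] torus_proj_lift[of y] by blast
  moreover have "bdd_below ?S"
    by (rule bdd_belowI[of _ 0]) auto
  ultimately show ?thesis
    unfolding torus_dist_def by (subst cInf_less_iff) auto
qed

text \<open>By translation invariance one of the two representatives can be prescribed. This is how
  statements about the torus distance are moved to \<^typ>\<open>real^'d\<close>; the strict inequality spares
  the argument that the infimum is attained.\<close>

lemma torus_dist_less_iff:
  "torus_dist x (torus_proj b) < r \<longleftrightarrow> (\<exists>a. torus_proj a = x \<and> norm (a - b) < r)"
proof
  assume "torus_dist x (torus_proj b) < r"
  then obtain a b' where *: "torus_proj a = x" "torus_proj b' = torus_proj b" "norm (a - b') < r"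
    by (auto simp: torus_dist_less_iff_pair)
  have "torus_proj (a - b' + b) = x"
    using * by (simp add: torus_proj_add torus_proj_diff)
  moreover have "norm ((a - b' + b) - b) < r"
    using * by simp
  ultimately show "\<exists>a. torus_proj a = x \<and> norm (a - b) < r"
    by blast
qed (auto simp: torus_dist_less_iff_pair)

lemma torus_dist_nonneg: "0 \<le> torus_dist x y"
  by (rule leI) (simp add: torus_dist_less_iff_pair not_less)

lemma torus_dist_zero_le_card: "torus_dist (x :: 'd::finite torus) 0 \<le> real CARD('d)"
proof (rule dense_ge)
  fix r assume r: "real CARD('d) < r"
  have "norm (torus_lift x) \<le> (\<Sum>j\<in>UNIV. \<bar>torus_lift x $ j\<bar>)"
    by (rule norm_le_l1_cart)
  also have "\<dots> \<le> (\<Sum>j\<in>(UNIV :: 'd set). 1)"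
    using torus_lift_mem[of x] by (intro sum_mono) (simp add: unit_cube_def less_imp_le)
  finally have "norm (torus_lift x - 0) < r"
    using r by simp
  then have "torus_dist x (torus_proj 0) < r"
    unfolding torus_dist_less_iff using torus_proj_lift by blast
  then show "torus_dist x 0 \<le> r"
    by (simp add: torus_proj_zero)
qed

lemma torus_dist_add_less:
  assumes "torus_dist x (torus_proj b) < r"
  shows "torus_dist (x + z) (torus_proj b) < r + torus_dist z 0"
proof -
  obtain a where a: "torus_proj a = x" "norm (a - b) < r"
    using assms by (auto simp: torus_dist_less_iff)
  have "torus_dist z (torus_proj 0) < torus_dist z 0 + (r - norm (a - b))"
    using a by (simp add: torus_proj_zero)
  then obtain v where v: "torus_proj v = z" "norm v < torus_dist z 0 + (r - norm (a - b))"
    by (auto simp: torus_dist_less_iff)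
  have "norm ((a + v) - b) < r + torus_dist z 0"
    using norm_triangle_ineq[of "a - b" v] v by (simp add: algebra_simps)
  then show ?thesis
    using a v by (auto simp: torus_dist_less_iff torus_proj_add intro!: exI[of _ "a + v"])
qed

lemma open_torus_dist_less: "open {x :: 'd::finite torus. torus_dist x (torus_proj b) < r}"
proof -
  have "torus_proj -` {x :: 'd torus. torus_dist x (torus_proj b) < r}
      = (\<Union>k\<in>{k. torus_proj k = 0}. ball (b + k) r)"
  proof (intro set_eqI iffI)
    fix a :: "real^'d" assume "a \<in> torus_proj -` {x. torus_dist x (torus_proj b) < r}"
    then obtain a' where a': "torus_proj a' = torus_proj a" "norm (a' - b) < r"
      by (auto simp: torus_dist_less_iff)
    have "a \<in> ball (b + (a - a')) r"
      using a' by (simp add: dist_norm norm_minus_commute algebra_simps)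
    moreover have "torus_proj (a - a') = 0"
      using a' by (simp add: torus_proj_diff)
    ultimately show "a \<in> (\<Union>k\<in>{k. torus_proj k = 0}. ball (b + k) r)"
      by blast
  next
    fix a assume "a \<in> (\<Union>k\<in>{k. torus_proj k = 0}. ball (b + k) r)"
    then obtain k where k: "torus_proj k = 0" "a \<in> ball (b + k) r"
      by blast
    have "torus_proj (a - k) = torus_proj a"
      using k by (simp add: torus_proj_diff)
    moreover have "norm ((a - k) - b) < r"
      using k by (simp add: dist_norm norm_minus_commute algebra_simps)
    ultimately show "a \<in> torus_proj -` {x. torus_dist x (torus_proj b) < r}"
      by (auto simp: torus_dist_less_iff)
  qed
  moreover have "open (\<Union>k\<in>{k. torus_proj k = 0}. ball (b + k) r)"
    by (intro open_UN) auto
  ultimately show ?thesis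
    unfolding open_torus_def by (simp only:)
qed

lemma borel_measurable_torus_dist_zero [measurable]:
  "(\<lambda>x. torus_dist x 0) \<in> borel_measurable borel"
proof (unfold borel_measurable_iff_less, intro allI)
  fix c
  show "{x \<in> space borel. torus_dist x 0 < c} \<in> sets borel"
    using borel_open[OF open_torus_dist_less[of 0 c]] by (simp add: torus_proj_zero)
qed

lemma measurable_torus_proj [measurable]: "torus_proj \<in> borel_measurable borel"
  by (rule borel_measurable_continuous_onI)
    (simp add: continuous_on_open_vimage open_torus_def)

lemma closed_singleton_torus: "closed {x :: 'd::finite torus}"
proof -
  obtain a where a: "x = torus_proj a"
    using torus_proj_lift by metis
  have "torus_proj -` {x} = (\<Inter>j. (\<lambda>b. b $ j - a $ j) -` \<int>)"
    by (auto simp: a torus_proj_eq_iff same_mod_int_def)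
  moreover have "closed ((\<lambda>b::real^'d. b $ j - a $ j) -` \<int>)" for j
    by (intro continuous_closed_vimage closed_Ints continuous_intros)
  ultimately have "closed (torus_proj -` {x})"
    by auto
  then show ?thesis
    by (simp add: closed_def open_torus_def vimage_Compl)
qed

text \<open>The lift jumps at the faces of the cube, but each coordinate of it is lower semicontinuous:
  the fractional part exceeds \<open>c \<ge> 0\<close> exactly on the open intervals from \<open>n + c\<close> to \<open>n + 1\<close>.\<close>

lemma measurable_torus_lift [measurable]: "torus_lift \<in> borel_measurable borel"
proof -
  have lift_frac: "torus_lift (torus_proj a) $ j = frac (a $ j)" for a :: "real^'a" and j
  proof -
    have "torus_lift (torus_proj a) = (\<chi> j. frac (a $ j))"
      unfolding torus_lift_def
      by (rule the1_equality[OF ex1_lift])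
        (simp add: unit_cube_def frac_lt_1 torus_proj_eq_iff same_mod_int_def, simp add: frac_def)
    then show ?thesis
      by simp
  qed
  have frac_gr: "frac t > c \<longleftrightarrow> t \<in> (\<Union>n::int. {of_int n + c <..< of_int n + 1})"
    if "c \<ge> 0" for c t :: real
  proof
    assume "frac t > c"
    then have "t \<in> {of_int \<lfloor>t\<rfloor> + c <..< of_int \<lfloor>t\<rfloor> + 1}"
      by (auto simp: frac_def)
    then show "t \<in> (\<Union>n::int. {of_int n + c <..< of_int n + 1})"
      by blast
  next
    assume "t \<in> (\<Union>n::int. {of_int n + c <..< of_int n + 1})"
    then obtain n :: int where n: "of_int n + c < t" "t < of_int n + 1"
      by auto
    with that have "\<lfloor>t\<rfloor> = n"
      by (intro floor_unique) auto
    with n show "frac t > c"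
      by (simp add: frac_def)
  qed
  have "open {x :: 'a torus. c < torus_lift x $ j}" for c j
  proof (cases "c \<ge> 0")
    case True
    have "torus_proj -` {x :: 'a torus. c < torus_lift x $ j}
        = (\<Union>n::int. (\<lambda>a. a $ j) -` {of_int n + c <..< of_int n + 1})"
      using frac_gr[OF True] by (auto simp: lift_frac)
    moreover have "open ((\<lambda>a :: real^'a. a $ j) -` {of_int n + c <..< of_int n + 1})" for n
      by (intro open_vimage continuous_intros)
    ultimately show ?thesis
      by (auto simp: open_torus_def)
  next
    case False
    have "0 \<le> torus_lift x $ j" for x :: "'a torus"
      using torus_lift_mem[of x] by (simp add: unit_cube_def)
    then have "c < torus_lift x $ j" for x :: "'a torus"
      using False by (meson less_le_trans not_le)
    then have "{x :: 'a torus. c < torus_lift x $ j} = UNIV"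
      by blast
    then show ?thesis
      by simp
  qed
  then have "(\<lambda>x :: 'a torus. torus_lift x $ j) \<in> borel_measurable borel" for j
    by (simp add: borel_measurable_iff_greater)
  then have "(\<lambda>x :: 'a torus. torus_lift x \<bullet> b) \<in> borel_measurable borel" if "b \<in> Basis" for b
    using that by (auto simp: Basis_vec_def cart_eq_inner_axis)
  then show ?thesis
    by (rule borel_measurable_euclidean_space[THEN iffD2, OF ballI])
qed

text \<open>Passing to representatives reduces this to addition on \<^typ>\<open>real^'d\<close>, where joint
  measurability is known.\<close>

lemma measurable_torus_add:
  assumes "f \<in> borel_measurable N" and "g \<in> borel_measurable N"
  shows "(\<lambda>x. f x + g x :: 'd::finite torus) \<in> borel_measurable N"
proof -
  note assms [measurable]
  have "(\<lambda>x. f x + g x) = (\<lambda>x. torus_proj (torus_lift (f x) + torus_lift (g x)))"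
    by (simp add: torus_proj_add)
  then show ?thesis
    by simp
qed

lemma unit_cube_borel: "(unit_cube :: (real^'d) set) \<in> sets borel"
proof -
  have "(\<Inter>j. {a :: real^'d. 0 \<le> a $ j \<and> a $ j < 1}) \<in> sets borel"
    by (intro sets.finite_INT) auto
  also have "(\<Inter>j. {a :: real^'d. 0 \<le> a $ j \<and> a $ j < 1}) = unit_cube"
    by (auto simp: unit_cube_def)
  finally show ?thesis .
qed

lemma torus_lebesgue_measure:
  assumes "A \<in> sets borel"
  shows "emeasure torus_lebesgue A = emeasure lborel {a \<in> unit_cube. torus_proj a \<in> A}"
proof -
  have "torus_proj \<in> measurable (restrict_space lborel unit_cube) borel"
    by (rule measurable_restrict_space1) simp
  then have "emeasure torus_lebesgue A
      = emeasure (restrict_space lborel unit_cube) (torus_proj -` A \<inter> unit_cube)"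
    using assms unfolding torus_lebesgue_def
    by (subst emeasure_distr) (auto simp: space_restrict_space)
  also have "\<dots> = emeasure lborel (torus_proj -` A \<inter> unit_cube)"
    using unit_cube_borel by (subst emeasure_restrict_space) auto
  also have "torus_proj -` A \<inter> unit_cube = {a \<in> unit_cube. torus_proj a \<in> A}"
    by auto
  finally show ?thesis .
qed

lemma sets_torus_lebesgue [simp]: "sets torus_lebesgue = sets borel"
  by (simp add: torus_lebesgue_def)

abbreviation cube_center :: "real^'d" where
  "cube_center \<equiv> \<chi> j. 1 / 2"

lemma ball_cube_center_subset:
  assumes "r \<le> 1 / 2"
  shows "ball (cube_center :: real^'d) r \<subseteq> unit_cube"
proof
  fix a :: "real^'d" assume "a \<in> ball cube_center r"
  then have "norm (a - cube_center) < r"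
    by (simp add: dist_norm norm_minus_commute)
  then have "\<bar>a $ j - 1 / 2\<bar> < 1 / 2" for j
    using component_le_norm_cart[of "a - cube_center" j] assms by simp
  then have "0 \<le> a $ j \<and> a $ j < 1" for j
    using abs_less_iff[of "a $ j - 1 / 2" "1 / 2"] by (smt (verit) field_sum_of_halves)
  then show "a \<in> unit_cube"
    by (simp add: unit_cube_def)
qed

text \<open>For \<open>r \<le> 1/2\<close> the ball about the centre sits in the cube, so it is not folded over itself by
  the projection and is contained in a cube of side \<open>2 * r\<close>.\<close>

lemma torus_lebesgue_ball_le:
  assumes r: "0 < r" "r \<le> 1 / 2"
  shows "measure torus_lebesgue {x :: 'd::finite torus. torus_dist x (torus_proj cube_center) < r}
      \<le> 2 * r"
proof -
  let ?A = "{x :: 'd torus. torus_dist x (torus_proj cube_center) < r}"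
  let ?u = "(\<chi> j. 1 / 2 - r) :: real^'d" and ?v = "(\<chi> j. 1 / 2 + r) :: real^'d"
  have "{a \<in> unit_cube. torus_proj a \<in> ?A} \<subseteq> cbox ?u ?v"
  proof clarsimp
    fix a :: "real^'d"
    assume a: "a \<in> unit_cube" "torus_dist (torus_proj a) (torus_proj cube_center) < r"
    then obtain b where b: "torus_proj b = torus_proj a" "norm (b - cube_center) < r"
      by (auto simp: torus_dist_less_iff)
    have "b \<in> unit_cube"
      using ball_cube_center_subset[OF r(2), where 'd='d] b
      by (auto simp: dist_norm norm_minus_commute)
    then have "b = a"
      using a(1) b(1) torus_lift_proj by metis
    then have "\<bar>a $ j - 1 / 2\<bar> < r" for j
      using component_le_norm_cart[of "a - cube_center" j] b(2) by simp
    then have "1 / 2 - r \<le> a $ j \<and> a $ j \<le> 1 / 2 + r" for j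
      by (smt (verit))
    then show "a \<in> cbox ?u ?v"
      by (simp add: mem_box_cart)
  qed
  then have "emeasure torus_lebesgue ?A \<le> emeasure lborel (cbox ?u ?v)"
    by (subst torus_lebesgue_measure) (auto intro!: emeasure_mono borel_open open_torus_dist_less)
  then have "measure torus_lebesgue ?A \<le> measure lborel (cbox ?u ?v)"
    unfolding measure_def by (intro enn2real_mono) (auto simp: emeasure_lborel_cbox_eq)
  also have "\<dots> = (2 * r) ^ CARD('d)"
  proof -
    have "?u \<in> cbox ?u ?v"
      using r by (simp add: mem_box_cart)
    then have "cbox ?u ?v \<noteq> {}"
      by blast
    then show ?thesis
      by (simp add: content_cbox_cart)
  qed
  also have "\<dots> \<le> (2 * r) ^ 1"
    using r by (intro power_decreasing) auto
  finally show ?thesis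
    by simp
qed

section \<open>Measurability of the Bernoulli map\<close>

lemma is_interval_borel_card_1:
  fixes S :: "(real^'d) set"
  assumes "CARD('d) = 1" and "is_interval S"
  shows "S \<in> sets borel"
proof -
  obtain k :: 'd where k: "UNIV = {k}"
    using assms(1) card_1_singletonE by blast
  have all_k: "j = k" for j
    using k by blast
  let ?J = "(\<lambda>t. \<chi> j. t) -` S :: real set"
  have "is_interval ?J"
    unfolding is_interval_1
  proof (intro ballI allI impI)
    fix s t u assume *: "s \<in> ?J" "u \<in> ?J" "s \<le> t \<and> t \<le> u"
    then show "t \<in> ?J"
      using assms(2) unfolding is_interval_cart vimage_eq
      by (metis (no_types, lifting) vec_lambda_beta)
  qed
  then have "?J \<in> sets borel"
    by (rule real_interval_borel_measurable)
  moreover have "S = (\<lambda>a. a $ k) -` ?J \<inter> space borel"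
  proof -
    have "(\<chi> j. a $ k) = a" for a :: "real^'d"
      by (simp add: vec_eq_iff) (metis all_k)
    then show ?thesis
      by auto
  qed
  ultimately show ?thesis
    using measurable_sets[of "\<lambda>a :: real^'d. a $ k" borel borel ?J] by simp
qed

lemma axis_cube_borel:
  fixes Q :: "(real^'d) set"
  assumes "axis_cube Q"
  shows "Q \<in> sets borel"
proof -
  obtain a :: "real^'d" and l :: real and I :: "'d \<Rightarrow> real set"
    where I: "\<forall>j. {a $ j <..< a $ j + l} \<subseteq> I j \<and> I j \<subseteq> {a $ j .. a $ j + l}"
      and Q: "Q = {x. \<forall>j. x $ j \<in> I j}"
    using assms unfolding axis_cube_def by blast
  have "I j \<in> sets borel" for j
  proof -
    have "I j = {a $ j <..< a $ j + l} \<union> I j \<inter> {a $ j, a $ j + l}"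
      using I[rule_format, of j] by force
    moreover have "I j \<inter> {a $ j, a $ j + l} \<in> sets borel"
      by (intro borel_closed finite_imp_closed) auto
    ultimately show ?thesis
      by (metis borel_open open_greaterThanLessThan sets.Un)
  qed
  then have "(\<lambda>x :: real^'d. x $ j) -` I j \<in> sets borel" for j
    using measurable_sets[of "\<lambda>x :: real^'d. x $ j" borel borel "I j"] by simp
  then have "(\<Inter>j. (\<lambda>x. x $ j) -` I j) \<in> sets borel"
    by (intro sets.finite_INT) auto
  also have "(\<Inter>j. (\<lambda>x. x $ j) -` I j) = Q"
    by (auto simp: Q)
  finally show ?thesis .
qed

context piecewise_affine_bernoulli
begin

lemma piece_subset: "i \<in> {1..M} \<Longrightarrow> E i \<subseteq> unit_cube"
  using pieces_cover by blast

lemma piece_borel: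
  assumes i: "i \<in> {1..M}"
  shows "E i \<in> sets borel"
proof (cases "CARD('d) = 1")
  case True
  then show ?thesis
    using is_interval_borel_card_1 pieces_intervals[OF _ i] by blast
next
  case False
  then have "CARD('d) > 1"
    using zero_less_card_finite[where 'a='d] by linarith
  then show ?thesis
    using axis_cube_borel pieces_cubes[OF _ i] by blast
qed

lemma mem_torus_piece_iff: "i \<in> {1..M} \<Longrightarrow> x \<in> torus_piece E i \<longleftrightarrow> torus_lift x \<in> E i"
  using piece_subset[of i] torus_lift_proj torus_proj_lift[of x]
  unfolding torus_piece_def by (metis image_iff subsetD)

lemma bernoulli_map_on_piece:
  assumes "i \<in> {1..M}" and "torus_lift x \<in> E i"
  shows "bernoulli_map M E D e x = torus_proj (affine_branch E D e i (torus_lift x))"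
proof -
  have "(THE j. j \<in> {1..M} \<and> x \<in> torus_piece E j) = i"
  proof (rule the_equality)
    show "i \<in> {1..M} \<and> x \<in> torus_piece E i"
      using assms by (simp add: mem_torus_piece_iff)
    show "j = i" if "j \<in> {1..M} \<and> x \<in> torus_piece E j" for j
      using that assms disjoint_family_onD[OF pieces_disjoint, of i j] mem_torus_piece_iff[of j x]
      by blast
  qed
  then show ?thesis
    by (simp add: bernoulli_map_def torus_branch_def)
qed

lemma measurable_affine_branch [measurable]: "affine_branch E D e i \<in> borel_measurable borel"
proof -
  have "continuous_on UNIV (affine_branch E D e i)"
    unfolding affine_branch_def [abs_def]
    by (intro continuous_intros matrix_vector_mult_linear_continuous_on)
  then show ?thesis
    by (rule borel_measurable_continuous_onI)
qed

lemma measurable_bernoulli_map: "bernoulli_map M E D e \<in> borel_measurable borel"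
proof (rule measurable_piecewise_restrict[of "(\<lambda>i. torus_lift -` E i) ` {1..M}"])
  show "countable ((\<lambda>i. torus_lift -` E i) ` {1..M})"
    by simp
next
  fix \<Omega> assume "\<Omega> \<in> (\<lambda>i. torus_lift -` E i) ` {1..M}"
  then obtain i where i: "i \<in> {1..M}" "\<Omega> = torus_lift -` E i"
    by blast
  show "\<Omega> \<inter> space borel \<in> sets borel"
    using measurable_sets[OF measurable_torus_lift piece_borel[OF i(1)]] i by simp
  have "(\<lambda>x. torus_proj (affine_branch E D e i (torus_lift x)))
      \<in> borel_measurable (restrict_space borel \<Omega>)"
    by (rule measurable_restrict_space1) measurable
  then show "bernoulli_map M E D e \<in> borel_measurable (restrict_space borel \<Omega>)"
    using i by (subst measurable_cong) (auto simp: space_restrict_space bernoulli_map_on_piece)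
next
  show "space borel \<subseteq> \<Union> ((\<lambda>i. torus_lift -` E i) ` {1..M})"
    using pieces_cover torus_lift_mem by fastforce
qed

end

section \<open>Orbits shadowed by the noisy process\<close>

context piecewise_affine_bernoulli
begin

definition expansion :: "nat \<Rightarrow> real" where
  "expansion i = piece_prob E i powr (- 1 / real CARD('d))"

lemma ln_expansion: "i \<in> {1..M} \<Longrightarrow> ln (expansion i) = - ln (piece_prob E i) / real CARD('d)"
  using piece_prob_pos[of i] by (simp add: expansion_def ln_powr)

lemma expansion_gt_1:
  assumes "i \<in> {1..M}"
  shows "1 < expansion i"
proof -
  have "0 < expansion i"
    using piece_prob_pos[OF assms] by (simp add: expansion_def)
  moreover have "0 < ln (expansion i)"
    using piece_prob_pos[OF assms] piece_prob_less_1[OF assms]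
    by (simp add: ln_expansion[OF assms] divide_neg_pos)
  ultimately show ?thesis
    by (simp add: ln_gt_zero_iff)
qed

lemma norm_affine_branch_diff:
  assumes "i \<in> {1..M}"
  shows "norm (affine_branch E D e i a - affine_branch E D e i b) = expansion i * norm (a - b)"
proof -
  have "orthogonal_transformation ((*v) (D i))"
    using orthogonal[OF assms]
    by (simp add: orthogonal_transformation_matrix matrix_of_matrix_vector_mul)
  then have "norm (D i *v (a - b)) = norm (a - b)"
    by (simp add: orthogonal_transformation_norm)
  moreover have "affine_branch E D e i a - affine_branch E D e i b
      = expansion i *\<^sub>R (D i *v (a - b))"
    by (simp add: affine_branch_def expansion_def matrix_vector_mult_diff_distrib
        scaleR_diff_right)
  ultimately show ?thesis
    using expansion_gt_1[OF assms] by simp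
qed

text \<open>The branch is injective on all of \<^typ>\<open>real^'d\<close>, so a point whose image lies in the unit
  cube is the point of the piece with that image. Balls inside the unit cube therefore pull back
  to balls inside the piece.\<close>

lemma ball_subset_piece:
  assumes i: "i \<in> {1..M}"
    and sub: "ball (affine_branch E D e i y) (expansion i * \<rho>) \<subseteq> unit_cube"
  shows "ball y \<rho> \<subseteq> E i"
proof
  fix a assume "a \<in> ball y \<rho>"
  then have "norm (affine_branch E D e i y - affine_branch E D e i a) < expansion i * \<rho>"
    using expansion_gt_1[OF i] by (simp add: norm_affine_branch_diff[OF i] dist_norm)
  then have "affine_branch E D e i a \<in> unit_cube"
    using sub by (auto simp: dist_norm)
  then obtain a' where a': "a' \<in> E i" "affine_branch E D e i a' = affine_branch E D e i a"
    using bij_betw_imp_surj_on[OF affine_bij[OF i]] by (metis imageE)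
  have "expansion i * norm (a' - a) = 0"
    using a'(2) norm_affine_branch_diff[OF i, of a' a] by simp
  then have "a' = a"
    using expansion_gt_1[OF i] by simp
  then show "a \<in> E i"
    using a' by simp
qed

text \<open>\<open>w m\<close> is the preimage of order \<open>m\<close> of the centre under branch \<open>i\<close>. The radii shrink exactly
  as the branch expands, so each ball is mapped onto the previous one.\<close>

lemma ex_backward_orbit:
  assumes i: "i \<in> {1..M}" and r: "r \<le> 1 / 2"
  shows "\<exists>w. w 0 = cube_center
     \<and> (\<forall>m. affine_branch E D e i (w (Suc m)) = w m
          \<and> ball (w (Suc m)) (r / expansion i ^ Suc m) \<subseteq> E i)"
proof -
  let ?f = "affine_branch E D e i" and ?q = "expansion i"
  define g where "g = inv_into (E i) ?f"
  define w where "w m = (g ^^ m) cube_center" for m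
  have \<lambda>: "1 < ?q"
    by (rule expansion_gt_1[OF i])
  have img: "?f ` E i = unit_cube"
    by (rule bij_betw_imp_surj_on[OF affine_bij[OF i]])
  have g: "g a \<in> E i" "?f (g a) = a" if "a \<in> unit_cube" for a
    using that unfolding g_def img[symmetric]
    by (rule inv_into_into, rule f_inv_into_f)
  have w_mem: "w m \<in> unit_cube" for m
  proof (induction m)
    case 0
    then show ?case
      by (simp add: w_def unit_cube_def)
  next
    case (Suc m)
    then show ?case
      using g(1)[of "w m"] piece_subset[OF i] by (auto simp: w_def)
  qed
  have step: "?f (w (Suc m)) = w m" for m
    using g(2)[OF w_mem[of m]] by (simp add: w_def)
  have ball_piece: "ball (w (Suc m)) (r / ?q ^ Suc m) \<subseteq> E i"
    if "ball (w m) (r / ?q ^ m) \<subseteq> unit_cube" for m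
    using that \<lambda> by (intro ball_subset_piece[OF i]) (simp add: step)
  have "ball (w m) (r / ?q ^ m) \<subseteq> unit_cube" for m
  proof (induction m)
    case 0
    then show ?case
      using ball_cube_center_subset[OF r] by (simp add: w_def)
  next
    case (Suc m)
    then show ?case
      using ball_piece[of m] piece_subset[OF i] by blast
  qed
  then show ?thesis
    using step ball_piece by (intro exI[of _ w]) (simp add: w_def)
qed

lemma bernoulli_map_dist_less:
  assumes i: "i \<in> {1..M}" and sub: "ball y \<rho> \<subseteq> E i" and dist: "torus_dist x (torus_proj y) < \<rho>"
  shows "torus_dist (bernoulli_map M E D e x) (torus_proj (affine_branch E D e i y))
    < expansion i * \<rho>"
proof -
  obtain a where a: "torus_proj a = x" "norm (a - y) < \<rho>"
    using dist by (auto simp: torus_dist_less_iff)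
  then have "a \<in> E i"
    using sub by (auto simp: dist_norm norm_minus_commute)
  then have "bernoulli_map M E D e x = torus_proj (affine_branch E D e i a)"
    using bernoulli_map_on_piece[OF i, of x] piece_subset[OF i] a(1) torus_lift_proj[of a] by auto
  moreover have "norm (affine_branch E D e i a - affine_branch E D e i y) < expansion i * \<rho>"
    using a(2) expansion_gt_1[OF i] by (simp add: norm_affine_branch_diff[OF i])
  ultimately show ?thesis
    by (auto simp: torus_dist_less_iff)
qed

text \<open>An error made at time \<open>j\<close> is magnified by the factor \<^term>\<open>expansion i ^ (n - j)\<close> by
  time \<open>n\<close>; discounting every error to time \<open>0\<close> turns the condition that the accumulated error
  stays below \<open>r\<close> into one condition on a single sum. Under it, the bound at time \<open>k\<close> leaves room
  for the errors to come, and at the same time keeps the perturbed orbit in the ball on which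
  the map is given by the branch \<open>i\<close>.\<close>

lemma perturbed_orbit_dist_less:
  assumes i: "i \<in> {1..M}"
    and w: "\<And>m. affine_branch E D e i (w (Suc m)) = w m"
      "\<And>m. ball (w (Suc m)) (r / expansion i ^ Suc m) \<subseteq> E i"
    and x: "x 0 = torus_proj (w n)" "\<And>k. x (Suc k) = bernoulli_map M E D e (x k) + z (Suc k)"
    and small: "(\<Sum>j<n. torus_dist (z (Suc j)) 0 / expansion i ^ Suc j) < r / expansion i ^ n"
  shows "torus_dist (x n) (torus_proj (w 0)) < r"
proof -
  let ?q = "expansion i"
  \<comment> \<open>\<open>R k\<close> is the discounted noise still to come after time \<open>k\<close>.\<close>
  define R where "R k = (\<Sum>j=k..<n. torus_dist (z (Suc j)) 0 / ?q ^ Suc j)" for k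
  have \<lambda>: "1 < ?q"
    by (rule expansion_gt_1[OF i])
  have R_nonneg: "0 \<le> R k" for k
    unfolding R_def using \<lambda> by (intro sum_nonneg divide_nonneg_nonneg torus_dist_nonneg) simp
  have "torus_dist (x k) (torus_proj (w (n - k))) < ?q ^ k * (r / ?q ^ n - R k)" if "k \<le> n" for k
    using that
  proof (induction k)
    case 0
    have "0 < r / ?q ^ n - R 0"
      using small by (simp add: R_def lessThan_atLeast0)
    then have "torus_dist (x 0) (torus_proj (w n)) < r / ?q ^ n - R 0"
      unfolding torus_dist_less_iff x(1) by (intro exI[of _ "w n"]) simp
    then show ?case
      by simp
  next
    case (Suc k)
    define m where "m = n - Suc k"
    have n: "n - k = Suc m" "n = k + Suc m"
      using Suc.prems by (auto simp: m_def)
    let ?\<rho> = "?q ^ k * (r / ?q ^ n - R k)"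
    have "?\<rho> \<le> ?q ^ k * (r / ?q ^ n)"
      using R_nonneg[of k] \<lambda> by (intro mult_left_mono) auto
    also have "\<dots> = r / ?q ^ Suc m"
      using \<lambda> by (simp add: n(2) power_add)
    finally have "ball (w (Suc m)) ?\<rho> \<subseteq> E i"
      using w(2)[of m] subset_ball by blast
    moreover have "torus_dist (x k) (torus_proj (w (Suc m))) < ?\<rho>"
      using Suc n by simp
    ultimately have "torus_dist (bernoulli_map M E D e (x k)) (torus_proj (w m)) < ?q * ?\<rho>"
      using bernoulli_map_dist_less[OF i, of "w (Suc m)" ?\<rho> "x k"] w(1) by simp
    then have "torus_dist (x (Suc k)) (torus_proj (w m)) < ?q * ?\<rho> + torus_dist (z (Suc k)) 0"
      unfolding x(2) by (rule torus_dist_add_less)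
    also have "?q * ?\<rho> + torus_dist (z (Suc k)) 0 = ?q ^ Suc k * (r / ?q ^ n - R (Suc k))"
    proof -
      have "R k = torus_dist (z (Suc k)) 0 / ?q ^ Suc k + R (Suc k)"
        unfolding R_def using Suc.prems by (subst sum.atLeast_Suc_lessThan) auto
      moreover have "?q ^ Suc k * (torus_dist (z (Suc k)) 0 / ?q ^ Suc k) = torus_dist (z (Suc k)) 0"
        using \<lambda> by simp
      ultimately show ?thesis
        by (simp only: right_diff_distrib distrib_left power_Suc mult.assoc)
    qed
    finally show ?case
      by (simp add: m_def)
  qed
  from this[of n] \<lambda> show ?thesis
    by (simp add: R_def)
qed

end

section \<open>Concentration of the noisy process\<close>

lemma noisy_process_measurable:
  assumes process: "noisy_process \<phi> K P \<xi> X" and \<phi>: "\<phi> \<in> borel_measurable borel"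
  shows "X n \<in> borel_measurable P"
proof (induction n)
  interpret prob_space P
    using process by (simp add: noisy_process_def)
  case 0
  have "(\<xi>(0 := X 0)) 0 \<in> borel_measurable P"
    using process unfolding noisy_process_def indep_vars_def by blast
  then show ?case
    by simp
next
  case (Suc n)
  have "distributed P torus_lebesgue (\<xi> (Suc n)) (\<lambda>y. ennreal (K y))"
    using process by (simp add: noisy_process_def)
  then have "\<xi> (Suc n) \<in> borel_measurable P"
    by (auto simp: distributed_def cong: measurable_cong_sets)
  then have "(\<lambda>\<omega>. \<phi> (X n \<omega>) + \<xi> (Suc n) \<omega>) \<in> borel_measurable P"
    using measurable_compose[OF Suc \<phi>] by (intro measurable_torus_add)
  then show ?case
    using process by (subst measurable_cong) (auto simp: noisy_process_def)
qed

lemma sum_inverse_powers_le: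
  assumes "1 < (q :: real)"
  shows "(\<Sum>j<n. 1 / q ^ Suc j) \<le> 1 / (q - 1)"
proof -
  have "(\<Sum>j<n. 1 / q ^ Suc j) = (1 - 1 / q ^ n) / (q - 1)"
    using assms by (induction n) (simp_all add: divide_simps, simp_all add: algebra_simps)
  also have "\<dots> \<le> 1 / (q - 1)"
    using assms by (intro divide_right_mono) auto
  finally show ?thesis .
qed

text \<open>Markov's inequality. The geometric weights bound the mean of the sum by \<open>\<epsilon> / (q - 1)\<close>
  uniformly in \<open>n\<close>; this is where the moment condition on the noise enters.\<close>

lemma noise_sum_tail_le:
  fixes \<xi> :: "nat \<Rightarrow> 'w \<Rightarrow> 'd::finite torus"
  assumes process: "noisy_process \<phi> K P \<xi> X"
    and K_nonneg: "\<And>y. 0 \<le> K y"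
    and moment: "(LINT y|torus_lebesgue. torus_dist y 0 * K y) \<le> \<epsilon>"
    and q: "1 < q" and c: "0 < c"
  shows "measure P {\<omega> \<in> space P. c \<le> (\<Sum>j<n. torus_dist (\<xi> (Suc j) \<omega>) 0 / q ^ Suc j)}
    \<le> \<epsilon> / (c * (q - 1))"
proof -
  interpret prob_space P
    using process by (simp add: noisy_process_def)
  have dist: "distributed P torus_lebesgue (\<xi> (Suc j)) (\<lambda>y. ennreal (K y))" for j
    using process by (simp add: noisy_process_def)
  then have \<xi>: "\<xi> (Suc j) \<in> borel_measurable P" for j
    by (auto simp: distributed_def cong: measurable_cong_sets)
  have dist_meas: "(\<lambda>y :: 'd torus. torus_dist y 0) \<in> borel_measurable torus_lebesgue"
    using borel_measurable_torus_dist_zero by (simp cong: measurable_cong_sets)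
  have int: "integrable P (\<lambda>\<omega>. torus_dist (\<xi> (Suc j) \<omega>) 0)" for j
    using measurable_compose[OF \<xi> borel_measurable_torus_dist_zero] torus_dist_zero_le_card
    by (intro integrable_const_bound[of _ "real CARD('d)"]) (auto simp: torus_dist_nonneg)
  have mean: "(\<integral>\<omega>. torus_dist (\<xi> (Suc j) \<omega>) 0 \<partial>P) \<le> \<epsilon>" for j
    using distributed_integral[OF dist dist_meas K_nonneg, of j] moment by (simp add: mult.commute)
  have "0 \<le> \<epsilon>"
    using Bochner_Integration.integral_nonneg[of P "\<lambda>\<omega>. torus_dist (\<xi> (Suc 0) \<omega>) 0"] mean[of 0] torus_dist_nonneg
    by (meson order_trans)
  let ?S = "\<lambda>\<omega>. \<Sum>j<n. torus_dist (\<xi> (Suc j) \<omega>) 0 / q ^ Suc j"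
  have "(\<integral>\<omega>. ?S \<omega> \<partial>P) = (\<Sum>j<n. (\<integral>\<omega>. torus_dist (\<xi> (Suc j) \<omega>) 0 \<partial>P) / q ^ Suc j)"
    using int by (subst Bochner_Integration.integral_sum) auto
  also have "\<dots> \<le> (\<Sum>j<n. \<epsilon> * (1 / q ^ Suc j))"
    using mean q by (intro sum_mono) (simp add: divide_right_mono)
  also have "\<dots> = \<epsilon> * (\<Sum>j<n. 1 / q ^ Suc j)"
    by (rule sum_distrib_left [symmetric])
  also have "\<dots> \<le> \<epsilon> * (1 / (q - 1))"
    using sum_inverse_powers_le[OF q] \<open>0 \<le> \<epsilon>\<close> by (intro mult_left_mono)
  finally have mean_S: "(\<integral>\<omega>. ?S \<omega> \<partial>P) \<le> \<epsilon> / (q - 1)"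
    by simp
  have "measure P {\<omega> \<in> space P. c \<le> ?S \<omega>} \<le> (\<integral>\<omega>. ?S \<omega> \<partial>P) / c"
    using int q c
    by (intro integral_Markov_inequality_measure[where A = "{}"])
      (auto intro!: sum_nonneg divide_nonneg_nonneg simp: torus_dist_nonneg)
  also have "\<dots> \<le> \<epsilon> / (q - 1) / c"
    using mean_S c by (intro divide_right_mono) auto
  finally show ?thesis
    by (simp add: mult.commute)
qed

context piecewise_affine_bernoulli
begin

text \<open>The process is started at the preimage of order \<open>n\<close> of the centre under branch \<open>i\<close>: it
  misses the ball only if the discounted noise reaches \<open>r / expansion i ^ n\<close>.\<close>

lemma ex_concentrated_process:
  fixes K :: "'d torus \<Rightarrow> real"
  assumes i: "i \<in> {1..M}" and r: "0 < r" "r \<le> 1 / 2"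
    and K: "K \<in> borel_measurable torus_lebesgue" "\<And>y. 0 \<le> K y"
      "prob_space (density torus_lebesgue (\<lambda>y. ennreal (K y)))"
    and moment: "(LINT y|torus_lebesgue. torus_dist y 0 * K y) \<le> \<epsilon>"
  shows "\<exists>(P :: (nat \<Rightarrow> 'd torus) measure) \<xi> X.
    noisy_process (bernoulli_map M E D e) K P \<xi> X \<and> X n \<in> borel_measurable P
    \<and> 1 - \<epsilon> * expansion i ^ n / (r * (expansion i - 1))
      \<le> measure (distr P borel (X n)) {x. torus_dist x (torus_proj cube_center) < r}"
proof -
  let ?q = "expansion i" and ?A = "{x :: 'd torus. torus_dist x (torus_proj cube_center) < r}"
  obtain w where w: "w 0 = cube_center" "\<And>m. affine_branch E D e i (w (Suc m)) = w m"
      "\<And>m. ball (w (Suc m)) (r / ?q ^ Suc m) \<subseteq> E i"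
    using ex_backward_orbit[OF i r(2)] by blast
  let ?x0 = "torus_proj (w n)"
  obtain P :: "(nat \<Rightarrow> 'd torus) measure" and \<xi> X
    where process: "noisy_process (bernoulli_map M E D e) K P \<xi> X"
      and init: "distr P borel (X 0) = return borel ?x0"
    using noisy_process_exists[where \<phi> = "bernoulli_map M E D e" and \<mu> = "return borel ?x0",
        OF prob_space_return sets_return K(1,3)] by auto
  interpret prob_space P
    using process by (simp add: noisy_process_def)
  have X [measurable]: "X k \<in> borel_measurable P" for k
    by (rule noisy_process_measurable[OF process measurable_bernoulli_map])
  have \<lambda>: "1 < ?q"
    by (rule expansion_gt_1[OF i])
  have A: "?A \<in> sets borel"
    by (rule borel_open[OF open_torus_dist_less])
  have "{?x0} \<in> sets borel"
    by (rule borel_closed[OF closed_singleton_torus])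
  then have "AE x in distr P borel (X 0). x = ?x0"
    unfolding init by (subst AE_return) (simp_all add: Measurable.pred_def)
  then have start: "AE \<omega> in P. X 0 \<omega> = ?x0"
    by (rule AE_distrD[OF X])
  let ?c = "r / ?q ^ n"
  let ?B = "{\<omega> \<in> space P. ?c \<le> (\<Sum>j<n. torus_dist (\<xi> (Suc j) \<omega>) 0 / ?q ^ Suc j)}"
  have "measure P ?B \<le> \<epsilon> / (?c * (?q - 1))"
    using \<lambda> r by (intro noise_sum_tail_le[OF process K(2) moment]) auto
  also have "\<dots> = \<epsilon> * ?q ^ n / (r * (?q - 1))"
    by simp
  finally have bad: "measure P ?B \<le> \<epsilon> * ?q ^ n / (r * (?q - 1))" .
  have "distributed P torus_lebesgue (\<xi> (Suc j)) (\<lambda>y. ennreal (K y))" for j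
    using process by (simp add: noisy_process_def)
  then have [measurable]: "\<xi> (Suc j) \<in> borel_measurable P" for j
    by (auto simp: distributed_def cong: measurable_cong_sets)
  have B: "?B \<in> events"
    by measurable
  have "1 - measure P ?B = measure P (space P - ?B)"
    by (rule prob_compl[OF B, symmetric])
  also have "\<dots> \<le> measure P (X n -` ?A \<inter> space P)"
  proof (rule finite_measure_mono_AE)
    show "AE \<omega> in P. \<omega> \<in> space P - ?B \<longrightarrow> \<omega> \<in> X n -` ?A \<inter> space P"
      using start
    proof (rule AE_mp, intro AE_I2 impI)
      fix \<omega> assume \<omega>: "\<omega> \<in> space P" "X 0 \<omega> = ?x0" "\<omega> \<in> space P - ?B"
      then have "torus_dist (X n \<omega>) (torus_proj (w 0)) < r"
        using process
        by (intro perturbed_orbit_dist_less[OF i w(2,3), where z = "\<lambda>k. \<xi> k \<omega>"])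
          (auto simp: noisy_process_def)
      then show "\<omega> \<in> X n -` ?A \<inter> space P"
        using \<omega> w(1) by simp
    qed
    show "X n -` ?A \<inter> space P \<in> events"
      by (rule measurable_sets[OF X A])
  qed
  also have "\<dots> = measure (distr P borel (X n)) ?A"
    by (rule measure_distr[OF X A, symmetric])
  finally have "1 - \<epsilon> * ?q ^ n / (r * (?q - 1)) \<le> measure (distr P borel (X n)) ?A"
    using bad by linarith
  then show ?thesis
    using process X by blast
qed

end

lemma measure_diff_le_tv_dist:
  assumes "prob_space \<mu>" and "prob_space \<nu>" and "A \<in> sets \<nu>"
  shows "measure \<mu> A - measure \<nu> A \<le> tv_dist \<mu> \<nu>"
proof -
  interpret \<mu>: prob_space \<mu> by fact
  interpret \<nu>: prob_space \<nu> by fact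
  have "\<bar>measure \<mu> B - measure \<nu> B\<bar> \<le> 1" for B
    using \<mu>.prob_le_1[of B] \<nu>.prob_le_1[of B] measure_nonneg[of \<mu> B] measure_nonneg[of \<nu> B]
    by linarith
  then have "bdd_above ((\<lambda>B. \<bar>measure \<mu> B - measure \<nu> B\<bar>) ` sets \<nu>)"
    by (intro bdd_aboveI2)
  then have "\<bar>measure \<mu> A - measure \<nu> A\<bar> \<le> tv_dist \<mu> \<nu>"
    unfolding tv_dist_def using assms(3) by (intro cSUP_upper)
  then show ?thesis
    by linarith
qed

lemma prob_space_torus_lebesgue: "prob_space (torus_lebesgue :: 'd::finite torus measure)"
proof
  have "{a \<in> unit_cube. torus_proj a \<in> (UNIV :: 'd torus set)} = unit_cube"
    by simp
  moreover have "emeasure lborel (unit_cube :: (real^'d) set) = 1"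
  proof (rule antisym)
    have one: "(1 :: real^'d) \<bullet> b = 1" if "b \<in> Basis" for b
      using that by (auto simp: Basis_vec_def inner_axis)
    have "emeasure lborel (unit_cube :: (real^'d) set) \<le> emeasure lborel (cbox (0 :: real^'d) 1)"
      by (intro emeasure_mono) (auto simp: unit_cube_def mem_box_cart less_imp_le)
    then show "emeasure lborel (unit_cube :: (real^'d) set) \<le> 1"
      by (simp add: emeasure_lborel_cbox_eq one)
    have "emeasure lborel (box (0 :: real^'d) 1) \<le> emeasure lborel (unit_cube :: (real^'d) set)"
      using unit_cube_borel
      by (intro emeasure_mono) (auto simp: unit_cube_def mem_box_cart less_imp_le)
    then show "1 \<le> emeasure lborel (unit_cube :: (real^'d) set)"
      by (simp add: emeasure_lborel_box_eq one)
  qed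
  ultimately show "emeasure (torus_lebesgue :: 'd torus measure) (space torus_lebesgue) = 1"
    using torus_lebesgue_measure[of "UNIV :: 'd torus set"]
      sets_eq_imp_space_eq[OF sets_torus_lebesgue, where 'a1='d] by simp
qed

lemma le_ereal_of_enat_Inf:
  assumes "\<And>n. enat n \<in> S \<Longrightarrow> L \<le> real n"
  shows "ereal L \<le> ereal_of_enat (Inf S)"
proof (cases "S = {}")
  case True
  then show ?thesis
    by (simp add: Inf_enat_def)
next
  case False
  then have "Inf S \<in> S"
    using wellorder_InfI by blast
  then show ?thesis
    using assms by (cases "Inf S") auto
qed

lemma le_mixing_time:
  fixes \<phi> :: "'d::finite torus \<Rightarrow> 'd torus"
  assumes "\<And>n. real n < L \<Longrightarrow>
    \<exists>(P :: (nat \<Rightarrow> 'd torus) measure) \<xi> X. noisy_process \<phi> K P \<xi> X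
      \<and> \<delta> < tv_dist (distr P borel (X n)) torus_lebesgue"
  shows "ereal L \<le> ereal_of_enat (mixing_time \<phi> K \<delta>)"
  unfolding mixing_time_def
proof (rule le_ereal_of_enat_Inf)
  fix n
  assume "enat n \<in> {enat n | n. \<forall>(P :: (nat \<Rightarrow> 'd torus) measure) \<xi> X.
    noisy_process \<phi> K P \<xi> X \<longrightarrow> tv_dist (distr P borel (X n)) torus_lebesgue \<le> \<delta>}"
  then have "\<forall>(P :: (nat \<Rightarrow> 'd torus) measure) \<xi> X.
    noisy_process \<phi> K P \<xi> X \<longrightarrow> tv_dist (distr P borel (X n)) torus_lebesgue \<le> \<delta>"
    by blast
  then show "L \<le> real n"
    using assms[of n] by (meson not_less)
qed

section \<open>The lower bound\<close>

context piecewise_affine_bernoulli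
begin

text \<open>With \<open>r = (1 - \<delta>) / 8\<close> the target ball has Lebesgue measure at most \<open>(1 - \<delta>) / 4\<close>, and the
  hypothesis on \<open>n\<close> makes the probability of missing it at most \<open>(1 - \<delta>) / 4\<close> too. The total
  variation distance is then at least \<open>1 - (1 - \<delta>) / 2 > \<delta>\<close>.\<close>

lemma ex_process_tv_dist_gt:
  fixes K :: "'d torus \<Rightarrow> real"
  assumes i: "i \<in> {1..M}" and \<delta>: "0 < \<delta>" "\<delta> < 1"
    and K: "K \<in> borel_measurable torus_lebesgue" "\<And>y. 0 \<le> K y"
      "prob_space (density torus_lebesgue (\<lambda>y. ennreal (K y)))"
    and moment: "(LINT y|torus_lebesgue. torus_dist y 0 * K y) \<le> \<epsilon>"
    and n: "\<epsilon> * expansion i ^ n \<le> (1 - \<delta>)\<^sup>2 * ((expansion i - 1) / 32)"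
  shows "\<exists>(P :: (nat \<Rightarrow> 'd torus) measure) \<xi> X.
    noisy_process (bernoulli_map M E D e) K P \<xi> X
    \<and> \<delta> < tv_dist (distr P borel (X n)) torus_lebesgue"
proof -
  define r where "r = (1 - \<delta>) / 8"
  have r: "0 < r" "r \<le> 1 / 2"
    using \<delta> by (auto simp: r_def)
  let ?A = "{x :: 'd torus. torus_dist x (torus_proj cube_center) < r}"
  obtain P :: "(nat \<Rightarrow> 'd torus) measure" and \<xi> X
    where process: "noisy_process (bernoulli_map M E D e) K P \<xi> X"
      and X: "X n \<in> borel_measurable P"
      and hit: "1 - \<epsilon> * expansion i ^ n / (r * (expansion i - 1))
        \<le> measure (distr P borel (X n)) ?A"
    using ex_concentrated_process[OF i r K moment, of n] by blast
  interpret prob_space P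
    using process by (simp add: noisy_process_def)
  have "\<epsilon> * expansion i ^ n / (r * (expansion i - 1))
      \<le> (1 - \<delta>)\<^sup>2 * ((expansion i - 1) / 32) / (r * (expansion i - 1))"
    using n r expansion_gt_1[OF i] by (intro divide_right_mono) auto
  also have "\<dots> = (1 - \<delta>) / 4"
    using \<delta> expansion_gt_1[OF i] by (simp add: r_def power2_eq_square)
  finally have "1 - (1 - \<delta>) / 4 \<le> measure (distr P borel (X n)) ?A"
    using hit by linarith
  moreover have "measure torus_lebesgue ?A \<le> (1 - \<delta>) / 4"
    using torus_lebesgue_ball_le[OF r, where 'd='d] by (simp add: r_def)
  moreover have "measure (distr P borel (X n)) ?A - measure torus_lebesgue ?A
      \<le> tv_dist (distr P borel (X n)) torus_lebesgue"
    by (intro measure_diff_le_tv_dist prob_space_distr X prob_space_torus_lebesgue)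
      (simp add: borel_open open_torus_dist_less)
  ultimately have "1 - (1 - \<delta>) / 2 \<le> tv_dist (distr P borel (X n)) torus_lebesgue"
    by linarith
  moreover have "\<delta> < 1 - (1 - \<delta>) / 2"
    using \<delta> by (simp add: field_simps)
  ultimately have "\<delta> < tv_dist (distr P borel (X n)) torus_lebesgue"
    by linarith
  then show ?thesis
    using process by blast
qed

lemma ex_p_max_piece: "\<exists>i\<in>{1..M}. piece_prob E i = p_max M E"
proof -
  have "Max (piece_prob E ` {1..M}) \<in> piece_prob E ` {1..M}"
    using two_pieces by (intro Max_in) auto
  then show ?thesis
    unfolding p_max_def by (metis imageE)
qed

end

theorem theorem1p2:
  fixes M :: nat
    and E :: "nat \<Rightarrow> (real^'d::finite) set"
    and D :: "nat \<Rightarrow> real^'d^'d"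
    and e :: "nat \<Rightarrow> real^'d"
    and K :: "real \<Rightarrow> 'd torus \<Rightarrow> real"
  assumes map: "piecewise_affine_bernoulli M E D e"
    and cubes: "cubes_assumption M E D e"
    and K_measurable: "\<And>\<epsilon>. 0 < \<epsilon> \<Longrightarrow> K \<epsilon> \<in> borel_measurable torus_lebesgue"
    and K_nonneg: "\<And>\<epsilon> y. 0 < \<epsilon> \<Longrightarrow> 0 \<le> K \<epsilon> y"
    and K_density: "\<And>\<epsilon>. 0 < \<epsilon> \<Longrightarrow>
          prob_space (density torus_lebesgue (\<lambda>y. ennreal (K \<epsilon> y)))"
    and K_moment: "\<forall>\<^sub>F \<epsilon> in at_right 0.
          (LINT y|torus_lebesgue. torus_dist y 0 * K \<epsilon> y) \<le> \<epsilon>"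
  shows "\<exists>C::real. \<forall>\<delta>\<in>{0<..<1}. \<forall>\<^sub>F \<epsilon> in at_right 0.
           ereal (real CARD('d) * ln \<epsilon> / ln (p_max M E) - C * (1 + \<bar>ln (1 - \<delta>)\<bar>))
             \<le> ereal_of_enat (mixing_time (bernoulli_map M E D e) (K \<epsilon>) \<delta>)"
proof -
  interpret piecewise_affine_bernoulli M E D e
    by (rule map)
  obtain i where i: "i \<in> {1..M}" "piece_prob E i = p_max M E"
    using ex_p_max_piece by blast
  define q where "q = expansion i"
  have q: "1 < q"
    unfolding q_def by (rule expansion_gt_1[OF i(1)])
  have ln_q: "0 < ln q"
    using q by simp
  \<comment> \<open>\<open>C\<close> absorbs the factors \<open>(1 - \<delta>)\<^sup>2\<close> and \<open>(q - 1) / 32\<close> of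
    \<open>ex_process_tv_dist_gt\<close> after taking logarithms.\<close>
  define b where "b = ln ((q - 1) / 32)"
  define C where "C = (2 + \<bar>b\<bar>) / ln q"
  have "\<forall>\<^sub>F \<epsilon> in at_right 0. ereal (real CARD('d) * ln \<epsilon> / ln (p_max M E) - C * (1 + \<bar>ln (1 - \<delta>)\<bar>))
      \<le> ereal_of_enat (mixing_time (bernoulli_map M E D e) (K \<epsilon>) \<delta>)"
    if \<delta>: "\<delta> \<in> {0<..<1}" for \<delta>
    using K_moment eventually_at_right_less[of 0]
  proof eventually_elim
    case (elim \<epsilon>)
    show ?case
    proof (rule le_mixing_time)
      fix n assume n: "real n < real CARD('d) * ln \<epsilon> / ln (p_max M E) - C * (1 + \<bar>ln (1 - \<delta>)\<bar>)"
      have "real CARD('d) * ln \<epsilon> / ln (p_max M E) = - ln \<epsilon> / ln q"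
        using ln_expansion[OF i(1)] i(2) by (simp add: q_def)
      then have "real n * ln q < (- ln \<epsilon> / ln q - C * (1 + \<bar>ln (1 - \<delta>)\<bar>)) * ln q"
        using n ln_q by (intro mult_strict_right_mono) auto
      also have "\<dots> = - ln \<epsilon> - (2 + \<bar>b\<bar>) * (1 + \<bar>ln (1 - \<delta>)\<bar>)"
        using ln_q by (simp add: C_def left_diff_distrib)
      also have "\<dots> \<le> - ln \<epsilon> - (\<bar>b\<bar> + 2 * \<bar>ln (1 - \<delta>)\<bar>)"
      proof -
        have "0 \<le> \<bar>b\<bar> * \<bar>ln (1 - \<delta>)\<bar>"
          by simp
        then show ?thesis
          by (simp add: algebra_simps)
      qed
      finally have "ln \<epsilon> + real n * ln q \<le> 2 * ln (1 - \<delta>) + b"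
        by linarith
      moreover have "ln (\<epsilon> * q ^ n) = ln \<epsilon> + real n * ln q"
        using elim q by (simp add: ln_mult ln_realpow)
      moreover have "ln ((1 - \<delta>)\<^sup>2 * ((q - 1) / 32)) = 2 * ln (1 - \<delta>) + b"
        using \<delta> q unfolding b_def by (subst ln_mult) (auto simp: ln_realpow)
      ultimately have "ln (\<epsilon> * q ^ n) \<le> ln ((1 - \<delta>)\<^sup>2 * ((q - 1) / 32))"
        by simp
      then have "\<epsilon> * q ^ n \<le> (1 - \<delta>)\<^sup>2 * ((q - 1) / 32)"
        using elim q \<delta> by (subst (asm) ln_le_cancel_iff) auto
      then show "\<exists>(P :: (nat \<Rightarrow> 'd torus) measure) \<xi> X.
          noisy_process (bernoulli_map M E D e) (K \<epsilon>) P \<xi> X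
          \<and> \<delta> < tv_dist (distr P borel (X n)) torus_lebesgue"
        using elim \<delta> K_measurable K_nonneg K_density unfolding q_def
        by (intro ex_process_tv_dist_gt[OF i(1)]) auto
    qed
  qed
  then show ?thesis
    by blast
qed

end
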